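(* Let $p$ be a real monic polynomial of degree $k\ge 2$ and let $\alpha\in\mathbb R$ be a real root of $p$ of multiplicity $d\geq 2$. Let $S$ be the secant map of $p$, and for each real root $\tau$ of $p$ let $\mathcal A(\tau)$ be the basin of $(\tau,\tau)$ under $S$ (both as defined in the context). Then the following hold. (a) If $d$ is odd, then $(\alpha,\alpha)\in\mathcal A(\alpha)$; indeed there is an open neighbourhood $U\subset\mathbb R^2$ of $(\alpha,\alpha)$ such that $U\subset \mathcal A(\alpha)$. (b) If $d$ is even, then $(\alpha,\alpha)\in\partial\mathcal A(\alpha)$. Moreover, $(\alpha,\alpha)$ belongs to the common boundary of all the basins associated to simple real roots of $p$, i.e. $$(\alpha,\alpha)\in \bigcap_{\tau\in\mathbb R,\ p(\tau)=0,\ p'(\tau)\neq 0}\partial\mathcal A(\tau).$$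
   Context: Multiplicity $d$ of $\alpha$ means $p^{(j)}(\alpha)=0$ for $0\le j\le d-1$ and $p^{(d)}(\alpha)\ne 0$. Let $q(x,y)$ be the symmetric polynomial with $p(x)-p(y)=(x-y)q(x,y)$. The secant map of $p$ is $$S(x,y)=\left(y,\ y-p(y)\frac{x-y}{p(x)-p(y)}\right)=\left(y,\ \frac{y\,q(x,y)-p(y)}{q(x,y)}\right),$$ where the last expression is used to define $S$ at every $(x,y)\in\mathbb R^2$ with $q(x,y)\neq 0$ (including points of the diagonal). In addition, one sets $S(\alpha,\alpha)=(\alpha,\alpha)$ for every real root $\alpha$ of $p$ (for a simple root this agrees with the formula; for a multiple root $q(\alpha,\alpha)=p'(\alpha)=0$ and it is a convention). At all other points with $q(x,y)=0$, $S$ is undefined. For a real root $\tau$ of $p$, the basin is $$\mathcal A(\tau)=\{(x,y)\in\mathbb R^2 : S^n(x,y)\text{ is defined for all } n\ge 0 \text{ and } S^n(x,y)\to(\tau,\tau) \text{ as } n\to\infty\}.$$ $\partial$ denotes the topological boundary in $\mathbb R^2$. If $p$ has no simple real root, the intersection over the empty family is understood as $\mathbb R^2$. *)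

theory Defs
  imports "HOL-Analysis.Analysis" "HOL-Computational_Algebra.Polynomial"
begin

definition has_multiplicity :: "real poly \<Rightarrow> real \<Rightarrow> nat \<Rightarrow> bool" where
  "has_multiplicity p a d \<longleftrightarrow>
     (\<forall>j<d. poly ((pderiv ^^ j) p) a = 0) \<and> poly ((pderiv ^^ d) p) a \<noteq> 0"

lemma has_multiplicity_iff_order: "has_multiplicity p a d \<longleftrightarrow> p \<noteq> 0 \<and> order a p = d"
proof (induction d arbitrary: p)
  case 0
  show ?case by (auto simp: has_multiplicity_def order_root)
next
  case (Suc d)
  have "has_multiplicity p a (Suc d) \<longleftrightarrow> poly p a = 0 \<and> has_multiplicity (pderiv p) a d"
    unfolding has_multiplicity_def
    by (auto simp: All_less_Suc2 funpow_Suc_right simp del: funpow.simps)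
  also have "\<dots> \<longleftrightarrow> poly p a = 0 \<and> pderiv p \<noteq> 0 \<and> order a (pderiv p) = d"
    using Suc.IH by simp
  also have "\<dots> \<longleftrightarrow> p \<noteq> 0 \<and> order a p = Suc d"
  proof (cases "pderiv p = 0")
    case True
    then obtain c where "p = [:c:]" by (metis pderiv_iszero)
    then show ?thesis by (auto simp: order_0I)
  next
    case False
    then have "p \<noteq> 0" by auto
    then show ?thesis using False order_pderiv[of p a] order_root[of p a] by auto
  qed
  finally show ?case .
qed

text \<open>
  The polynomial \<open>q\<close> with \<open>p(x) - p(y) = (x - y) q(x, y)\<close>, obtained by dividing each
  \<open>x^i - y^i\<close> by \<open>x - y\<close>; unlike the difference quotient it is also meaningful on the diagonal.
\<close>

definition secant_quot :: "real poly \<Rightarrow> real \<Rightarrow> real \<Rightarrow> real" where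
  "secant_quot p x y = (\<Sum>i\<le>degree p. coeff p i * (\<Sum>j<i. x ^ j * y ^ (i - Suc j)))"

lemma secant_quot: "poly p x - poly p y = (x - y) * secant_quot p x y"
proof -
  have "poly p x - poly p y = (\<Sum>i\<le>degree p. coeff p i * (x ^ i - y ^ i))"
    by (simp add: poly_altdef sum_subtractf algebra_simps)
  also have "\<dots> = (x - y) * secant_quot p x y"
    by (simp add: secant_quot_def sum_distrib_left power_diff_sumr2 mult_ac)
  finally show ?thesis .
qed

lemma secant_quot_commute: "secant_quot p x y = secant_quot p y x"
proof -
  have "(\<Sum>j<i. x ^ j * y ^ (i - Suc j)) = (\<Sum>j<i. y ^ j * x ^ (i - Suc j))" for i :: nat
    by (subst sum.nat_diff_reindex [symmetric]) (auto intro!: sum.cong simp: mult.commute)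
  then show ?thesis by (simp add: secant_quot_def)
qed

lemma secant_quot_diag: "secant_quot p x x = poly (pderiv p) x"
proof -
  have "(\<Sum>j<i. x ^ j * x ^ (i - Suc j)) = of_nat i * x ^ (i - 1)" for i :: nat
    by (simp flip: power_add)
  then have "secant_quot p x x = (\<Sum>i\<le>degree p. of_nat i * coeff p i * x ^ (i - 1))"
    by (simp add: secant_quot_def mult_ac)
  moreover have "((\<lambda>x. \<Sum>i\<le>degree p. coeff p i * x ^ i) has_real_derivative
      (\<Sum>i\<le>degree p. of_nat i * coeff p i * x ^ (i - 1))) (at x)"
    by (auto intro!: derivative_eq_intros sum.cong)
  ultimately have "(poly p has_real_derivative secant_quot p x x) (at x)"
    by (simp add: poly_altdef [abs_def])
  then show ?thesis by (rule DERIV_unique) (rule poly_DERIV)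
qed

text \<open>\<open>None\<close> means that the secant map is undefined at the given point.\<close>

definition secant_map :: "real poly \<Rightarrow> real \<times> real \<Rightarrow> (real \<times> real) option" where
  "secant_map p = (\<lambda>(x, y).
     if secant_quot p x y \<noteq> 0
     then Some (y, (y * secant_quot p x y - poly p y) / secant_quot p x y)
     else if x = y \<and> poly p x = 0 then Some (x, y)
     else None)"

lemma secant_map_root: "poly p a = 0 \<Longrightarrow> secant_map p (a, a) = Some (a, a)"
  by (simp add: secant_map_def)

lemma secant_map_off_diag:
  "poly p x \<noteq> poly p y \<Longrightarrow>
     secant_map p (x, y) = Some (y, y - poly p y * ((x - y) / (poly p x - poly p y)))"
proof -
  assume ne: "poly p x \<noteq> poly p y"
  then have "x \<noteq> y" and nz: "secant_quot p x y \<noteq> 0"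
    using secant_quot [of p x y] by auto
  then show ?thesis
    by (simp add: secant_map_def secant_quot diff_divide_eq_iff)
qed

primrec secant_iter :: "real poly \<Rightarrow> nat \<Rightarrow> real \<times> real \<Rightarrow> (real \<times> real) option" where
  "secant_iter p 0 z = Some z"
| "secant_iter p (Suc n) z = Option.bind (secant_iter p n z) (secant_map p)"

definition secant_basin :: "real poly \<Rightarrow> real \<Rightarrow> (real \<times> real) set" where
  "secant_basin p \<tau> =
     {z. (\<forall>n. secant_iter p n z \<noteq> None) \<and> (\<lambda>n. the (secant_iter p n z)) \<longlonglongrightarrow> (\<tau>, \<tau>)}"

end

theory Submission
  imports Defs
begin

text \<open>
  Write \<open>p x = (x - \<alpha>) ^ d * g x\<close> with \<open>g \<alpha> \<noteq> 0\<close>. The new coordinate produced by a secant step is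
  symmetric in \<open>x\<close> and \<open>y\<close>, so one may assume \<open>x - \<alpha> = t * (y - \<alpha>)\<close> with \<open>\<bar>t\<bar> \<le> 1\<close>. In these
  blow-up coordinates the step multiplies \<open>v = y - \<alpha>\<close> by a factor continuous in \<open>(t, v)\<close> that equals
  \<open>1 - 1 / (1 + t + \<dots> + t ^ (d - 1))\<close> at \<open>v = 0\<close>. For odd \<open>d\<close> this has modulus less than 1, and
  compactness of \<open>{-1..1}\<close> yields a uniform contraction near \<open>(\<alpha>, \<alpha>)\<close>.

  For even \<open>d\<close>, \<open>p\<close> has a strict local extremum at \<open>\<alpha>\<close>, so a nearly horizontal line through a graph
  point \<open>(y, p y)\<close> close to \<open>\<alpha>\<close> meets the graph again at some \<open>x\<close> on the other side of \<open>\<alpha>\<close>. A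
  horizontal line gives points where the secant map is undefined; the line through \<open>(\<tau>, 0)\<close>, for
  another root \<open>\<tau>\<close>, gives \<open>(x, y) \<mapsto> (y, \<tau>) \<mapsto> (\<tau>, \<tau>)\<close>.
\<close>

section \<open>The secant quotient\<close>

text \<open>A Leibniz rule: on the diagonal it is the product rule for \<open>pderiv\<close>;
  elsewhere the factor \<open>x - y\<close> is cancelled.\<close>

lemma secant_quot_mult:
  "secant_quot (p * q) x y = secant_quot p x y * poly q y + poly p x * secant_quot q x y"
proof (cases "x = y")
  case True
  then show ?thesis
    by (simp add: secant_quot_diag pderiv_mult algebra_simps)
next
  case False
  have "(x - y) * secant_quot (p * q) x y =
      (poly p x - poly p y) * poly q y + poly p x * (poly q x - poly q y)"
    unfolding secant_quot [symmetric] by (simp add: algebra_simps)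
  also have "\<dots> = (x - y) * (secant_quot p x y * poly q y + poly p x * secant_quot q x y)"
    unfolding secant_quot by (simp add: algebra_simps)
  finally have "(x - y) * secant_quot (p * q) x y =
      (x - y) * (secant_quot p x y * poly q y + poly p x * secant_quot q x y)" .
  with False show ?thesis by simp
qed

lemma secant_quot_linear_power:
  "secant_quot ([:-a, 1:] ^ d) x y = (\<Sum>j<d. (x - a) ^ j * (y - a) ^ (d - Suc j))"
proof (induction d)
  case 0
  show ?case by (simp add: secant_quot_def)
next
  case (Suc d)
  have "secant_quot [:-a, 1:] x y = 1"
    by (simp add: secant_quot_def)
  then have "secant_quot ([:-a, 1:] ^ Suc d) x y =
      (y - a) ^ d + (x - a) * (\<Sum>j<d. (x - a) ^ j * (y - a) ^ (d - Suc j))"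
    by (simp add: secant_quot_mult Suc poly_power del: mult_pCons_left mult_pCons_right)
  also have "\<dots> = (\<Sum>j<Suc d. (x - a) ^ j * (y - a) ^ (Suc d - Suc j))"
    by (simp add: sum.lessThan_Suc_shift sum_distrib_left mult_ac del: sum.lessThan_Suc)
  finally show ?case .
qed

lemma continuous_on_secant_quot [continuous_intros]:
  assumes "continuous_on A f" "continuous_on A h"
  shows "continuous_on A (\<lambda>z. secant_quot p (f z) (h z))"
  unfolding secant_quot_def using assms by (intro continuous_intros)

text \<open>Since \<open>poly p (a + v)\<close> is \<open>v ^ d * poly g (a + v)\<close>, the power
  \<open>v ^ (d - 1)\<close> cancels in the secant step. The remaining factor is continuous and
  reduces to the geometric sum times \<open>poly g a\<close> at \<open>v = 0\<close>.\<close>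

lemma secant_quot_blowup:
  fixes p g :: "real poly"
  assumes p: "p = [:-a, 1:] ^ d * g" and d: "d > 0"
  shows "secant_quot p (a + t * v) (a + v) =
    v ^ (d - 1) * ((\<Sum>j<d. t ^ j) * poly g (a + v)
                   + t ^ d * v * secant_quot g (a + t * v) (a + v))"
proof -
  have "secant_quot ([:-a, 1:] ^ d) (a + t * v) (a + v) = v ^ (d - 1) * (\<Sum>j<d. t ^ j)"
    unfolding secant_quot_linear_power sum_distrib_left
    by (intro sum.cong) (auto simp: power_mult_distrib mult_ac simp flip: power_add)
  moreover have "v ^ d = v ^ (d - 1) * v" using d by (simp flip: power_Suc2)
  ultimately show ?thesis
    unfolding p secant_quot_mult
    by (simp add: poly_power power_mult_distrib distrib_left mult_ac)
qed

lemma secant_step_symmetric: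
  "y * secant_quot p x y - poly p y = x * secant_quot p x y - poly p x"
  using secant_quot[of p x y] by (simp add: algebra_simps)

section \<open>Odd multiplicity\<close>

text \<open>The bound \<open>1 / 2\<close> is the threshold for contraction: for a sum
  \<open>h > 0\<close>, \<open>\<bar>1 - 1 / h\<bar> < 1\<close> holds exactly when
  \<open>h > 1 / 2\<close>.\<close>

lemma geometric_sum_gt_half:
  fixes t :: real
  assumes "odd d" "d \<ge> 2" "\<bar>t\<bar> \<le> 1"
  shows "(\<Sum>j<d. t ^ j) > 1 / 2"
proof (cases "t = 1")
  case True
  then show ?thesis using assms by simp
next
  case False
  with assms have t: "t < 1" "-1 \<le> t" by auto
  \<comment> \<open>This is the claim multiplied by \<open>2 * (1 - t)\<close>. Oddness of
    \<open>d\<close> makes \<open>t ^ d\<close> negative for negative \<open>t\<close>, which also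
    covers \<open>t = -1\<close>.\<close>
  have "2 * t ^ d < 1 + t"
  proof (cases "t > 0")
    case True
    then have "t ^ d \<le> t ^ 1"
      using t assms by (intro power_decreasing) auto
    then show ?thesis using t by simp
  next
    case False
    show ?thesis
    proof (cases "t = 0")
      case True
      then show ?thesis using assms by (simp add: power_0_left)
    next
      case False
      then have "t ^ d < 0" using \<open>\<not> t > 0\<close> assms by (simp add: power_less_zero_eq)
      then show ?thesis using t by linarith
    qed
  qed
  moreover have "(1 - t) * (\<Sum>j<d. t ^ j) = 1 - t ^ d"
    by (simp add: one_diff_power_eq)
  ultimately have "(1 - t) * (1 / 2) < (1 - t) * (\<Sum>j<d. t ^ j)" by simp
  then show ?thesis using t by (subst (asm) mult_less_cancel_left_pos) auto
qed

lemma secant_contraction_ordered: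
  fixes p g :: "real poly"
  assumes p: "p = [:-a, 1:] ^ d * g" and g: "poly g a \<noteq> 0" and d: "odd d" "d \<ge> 2"
  obtains c e where "0 \<le> c" "c < 1" "e > 0"
    "\<And>x y. \<bar>x - a\<bar> \<le> \<bar>y - a\<bar> \<Longrightarrow> y \<noteq> a \<Longrightarrow> \<bar>y - a\<bar> \<le> e \<Longrightarrow>
       secant_quot p x y \<noteq> 0 \<and>
       \<bar>(y * secant_quot p x y - poly p y) / secant_quot p x y - a\<bar> \<le> c * \<bar>y - a\<bar>"
proof -
  define H where "H = (\<lambda>(t, v). (\<Sum>j<d. t ^ j) * poly g (a + v)
                   + t ^ d * v * secant_quot g (a + t * v) (a + v))"
  define G where "G = (\<lambda>(t :: real, v). poly g (a + v))"
  have cH: "continuous_on A H" and cG: "continuous_on A G" for A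
    unfolding H_def G_def case_prod_unfold by (intro continuous_intros)+
  \<comment> \<open>The condition \<open>\<bar>1 - G z / H z\<bar> < 1\<close> with denominators
    cleared, so that \<open>W\<close> is open and \<open>H\<close> cannot vanish on it.\<close>
  define W where "W = {z. \<bar>H z - G z\<bar> < \<bar>H z\<bar>}"
  have "open W"
    unfolding W_def by (intro open_Collect_less continuous_intros cH cG)
  have sub: "{-1..1} \<times> {0} \<subseteq> W"
  proof clarify
    fix t :: real assume t: "t \<in> {-1..1}"
    then have h: "(\<Sum>j<d. t ^ j) > 1 / 2" using d by (intro geometric_sum_gt_half) auto
    then have "\<bar>(\<Sum>j<d. t ^ j) - 1\<bar> * \<bar>poly g a\<bar> < \<bar>\<Sum>j<d. t ^ j\<bar> * \<bar>poly g a\<bar>"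
      using g by (intro mult_strict_right_mono) auto
    then show "(t, 0) \<in> W"
      by (simp add: W_def H_def G_def left_diff_distrib flip: abs_mult)
  qed
  have "compact ({-1..1 :: real} \<times> {0 :: real})" by (intro compact_Times) auto
  then obtain e where e: "e > 0" "(\<Union>z\<in>{-1..1} \<times> {0}. cball z e) \<subseteq> W"
    using compact_subset_open_imp_cball_epsilon_subset[OF _ \<open>open W\<close> sub] by blast
  define K where "K = {-1..1 :: real} \<times> {-e..e}"
  have KW: "K \<subseteq> W"
  proof
    fix z assume "z \<in> K"
    then obtain t v where z: "z = (t, v)" "t \<in> {-1..1}" "v \<in> {-e..e}" by (auto simp: K_def)
    then have "z \<in> cball (t, 0) e" by (auto simp: dist_Pair_Pair dist_real_def)
    with z e(2) show "z \<in> W" by blast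
  qed
  then have H0: "H z \<noteq> 0" if "z \<in> K" for z using that by (auto simp: W_def)
  \<comment> \<open>The contraction factor attains its maximum on \<open>K\<close>; being less than
    1 pointwise, it is bounded by a single constant less than 1.\<close>
  have "compact K" "K \<noteq> {}"
    using e(1) by (auto simp: K_def intro!: compact_Times)
  moreover have "continuous_on K (\<lambda>z. \<bar>1 - G z / H z\<bar>)"
    using H0 by (intro continuous_intros cH cG) auto
  ultimately obtain z0 where z0: "z0 \<in> K" "\<And>z. z \<in> K \<Longrightarrow> \<bar>1 - G z / H z\<bar> \<le> \<bar>1 - G z0 / H z0\<bar>"
    using continuous_attains_sup by (metis (no_types, lifting))
  show thesis
  proof (rule that[of "\<bar>1 - G z0 / H z0\<bar>" e])
    have eq: "1 - G z0 / H z0 = (H z0 - G z0) / H z0"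
      using H0[OF z0(1)] by (simp add: diff_divide_distrib)
    show "\<bar>1 - G z0 / H z0\<bar> < 1"
      unfolding eq using KW z0(1) H0[OF z0(1)] by (auto simp: W_def)
  next
    fix x y assume xy: "\<bar>x - a\<bar> \<le> \<bar>y - a\<bar>" "y \<noteq> a" "\<bar>y - a\<bar> \<le> e"
    define v where "v = y - a"
    define t where "t = (x - a) / v"
    have v: "v \<noteq> 0" and y: "y = a + v" and x: "x = a + t * v"
      using xy by (auto simp: v_def t_def)
    have "\<bar>t\<bar> \<le> 1" using xy by (simp add: t_def v_def)
    then have K: "(t, v) \<in> K" using xy by (auto simp: K_def v_def)
    have q: "secant_quot p x y = v ^ (d - 1) * H (t, v)"
      using d unfolding x y by (subst secant_quot_blowup[OF p]) (auto simp: H_def)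
    then have q0: "secant_quot p x y \<noteq> 0" using v H0[OF K] by simp
    have "v ^ d = v ^ (d - 1) * v" using d by (simp flip: power_Suc2)
    then have "poly p y = v ^ (d - 1) * v * G (t, v)"
      unfolding y p by (simp add: G_def poly_power)
    then have "poly p y / secant_quot p x y = v * (G (t, v) / H (t, v))"
      using v unfolding q by simp
    then have "(y * secant_quot p x y - poly p y) / secant_quot p x y - a
        = v * (1 - G (t, v) / H (t, v))"
      using q0 y by (simp add: diff_divide_distrib right_diff_distrib)
    then have "\<bar>(y * secant_quot p x y - poly p y) / secant_quot p x y - a\<bar>
        = \<bar>1 - G (t, v) / H (t, v)\<bar> * \<bar>y - a\<bar>"
      by (simp add: abs_mult v_def)
    also have "\<dots> \<le> \<bar>1 - G z0 / H z0\<bar> * \<bar>y - a\<bar>"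
      using z0(2)[OF K] by (intro mult_right_mono) auto
    finally show "secant_quot p x y \<noteq> 0 \<and>
       \<bar>(y * secant_quot p x y - poly p y) / secant_quot p x y - a\<bar> \<le> \<bar>1 - G z0 / H z0\<bar> * \<bar>y - a\<bar>"
      using q0 by simp
  qed (use e in auto)
qed

text \<open>The ordering of \<open>x\<close> and \<open>y\<close> is removed by symmetry of the new
  coordinate. The point \<open>(a, a)\<close> is covered by the convention at roots.\<close>

lemma secant_contraction:
  fixes p g :: "real poly"
  assumes p: "p = [:-a, 1:] ^ d * g" and g: "poly g a \<noteq> 0" and d: "odd d" "d \<ge> 2"
  obtains c e where "0 \<le> c" "c < 1" "e > 0"
    "\<And>x y. \<bar>x - a\<bar> \<le> e \<Longrightarrow> \<bar>y - a\<bar> \<le> e \<Longrightarrow>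
       \<exists>w. secant_map p (x, y) = Some (y, w) \<and> \<bar>w - a\<bar> \<le> c * max \<bar>x - a\<bar> \<bar>y - a\<bar>"
proof -
  obtain c e where ce: "0 \<le> c" "c < 1" "e > 0"
    and *: "\<And>x y. \<bar>x - a\<bar> \<le> \<bar>y - a\<bar> \<Longrightarrow> y \<noteq> a \<Longrightarrow> \<bar>y - a\<bar> \<le> e \<Longrightarrow>
       secant_quot p x y \<noteq> 0 \<and>
       \<bar>(y * secant_quot p x y - poly p y) / secant_quot p x y - a\<bar> \<le> c * \<bar>y - a\<bar>"
    using secant_contraction_ordered[OF assms] by metis
  have root: "poly p a = 0" using d by (simp add: p poly_power)
  show thesis
  proof (rule that[OF ce])
    fix x y assume xy: "\<bar>x - a\<bar> \<le> e" "\<bar>y - a\<bar> \<le> e"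
    consider "x = a" "y = a" | "\<bar>x - a\<bar> \<le> \<bar>y - a\<bar>" "y \<noteq> a" | "\<bar>y - a\<bar> \<le> \<bar>x - a\<bar>" "x \<noteq> a"
      by fastforce
    then show "\<exists>w. secant_map p (x, y) = Some (y, w) \<and> \<bar>w - a\<bar> \<le> c * max \<bar>x - a\<bar> \<bar>y - a\<bar>"
    proof cases
      case 1
      then show ?thesis using root by (simp add: secant_map_root)
    next
      case 2
      then show ?thesis using *[of x y] xy by (simp add: secant_map_def max_def)
    next
      case 3
      then show ?thesis
        using *[of y x] xy
        by (simp add: secant_map_def max_def secant_step_symmetric[of y p x]
            secant_quot_commute[of p y x])
    qed
  qed
qed

text \<open>One step renews only one coordinate, so a factor \<open>c0\<close> is gained over two
  steps and the rate per step is a root of it.\<close>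

lemma odd_multiplicity_basin_neighbourhood:
  fixes p g :: "real poly"
  assumes p: "p = [:-a, 1:] ^ d * g" and g: "poly g a \<noteq> 0" and d: "odd d" "d \<ge> 2"
  shows "\<exists>U. open U \<and> (a, a) \<in> U \<and> U \<subseteq> secant_basin p a"
proof -
  obtain c0 e where ce: "0 \<le> c0" "c0 < 1" "e > 0"
    and *: "\<And>x y. \<bar>x - a\<bar> \<le> e \<Longrightarrow> \<bar>y - a\<bar> \<le> e \<Longrightarrow>
       \<exists>w. secant_map p (x, y) = Some (y, w) \<and> \<bar>w - a\<bar> \<le> c0 * max \<bar>x - a\<bar> \<bar>y - a\<bar>"
    using secant_contraction[OF assms] by metis
  \<comment> \<open>Averaging \<open>c0\<close> with 1 keeps \<open>b\<close> positive even when
    \<open>c0 = 0\<close>, while still \<open>c0 \<le> b ^ 2\<close> and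
    \<open>b < 1\<close>.\<close>
  define b where "b = sqrt ((1 + c0) / 2)"
  have b: "0 < b" "b < 1" and b2: "b ^ 2 = (1 + c0) / 2"
    using ce by (auto simp: b_def real_less_lsqrt)
  then have c0b: "c0 \<le> b ^ 2" using ce by simp
  \<comment> \<open>Radius \<open>e * b\<close> rather than \<open>e\<close>: at
    \<open>n = 0\<close> the invariant below already asks for \<open>e * b\<close> in the second
    coordinate.\<close>
  define U where "U = {a - e * b<..<a + e * b} \<times> {a - e * b<..<a + e * b}"
  have "U \<subseteq> secant_basin p a"
  proof
    fix z assume z: "z \<in> U"
    have iter: "\<exists>x y. secant_iter p n z = Some (x, y) \<and>
        \<bar>x - a\<bar> \<le> e * b ^ n \<and> \<bar>y - a\<bar> \<le> e * b ^ Suc n" for n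
    proof (induction n)
      case 0
      obtain x y where xy: "z = (x, y)" by (cases z)
      have "e * b \<le> e" using ce b by simp
      then show ?case using z xy by (auto simp: U_def abs_le_iff)
    next
      case (Suc n)
      then obtain x y where xy: "secant_iter p n z = Some (x, y)"
        "\<bar>x - a\<bar> \<le> e * b ^ n" "\<bar>y - a\<bar> \<le> e * b ^ Suc n" by blast
      have le: "e * b ^ Suc n \<le> e * b ^ n" "e * b ^ n \<le> e"
        using ce b by (auto simp: power_le_one mult_left_le_one_le)
      obtain w where w: "secant_map p (x, y) = Some (y, w)"
        "\<bar>w - a\<bar> \<le> c0 * max \<bar>x - a\<bar> \<bar>y - a\<bar>"
        using *[of x y] xy le by auto
      have "c0 * max \<bar>x - a\<bar> \<bar>y - a\<bar> \<le> b ^ 2 * (e * b ^ n)"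
        using xy le(1) ce c0b b by (intro mult_mono max.boundedI order.trans[OF xy(3)]) auto
      also have "\<dots> = e * b ^ Suc (Suc n)" by (simp add: power2_eq_square)
      finally show ?case using xy w by auto
    qed
    have lim: "(\<lambda>n. e * b ^ n) \<longlonglongrightarrow> 0"
      using b by (auto intro!: tendsto_mult_right_zero LIMSEQ_realpow_zero)
    have lim': "(\<lambda>n. e * b ^ Suc n) \<longlonglongrightarrow> 0" using LIMSEQ_Suc[OF lim] .
    let ?s = "\<lambda>n. the (secant_iter p n z)"
    have bd: "norm (fst (?s n) - a) \<le> e * b ^ n" "norm (snd (?s n) - a) \<le> e * b ^ Suc n" for n
      using iter[of n] by auto
    have "(\<lambda>n. fst (?s n) - a) \<longlonglongrightarrow> 0" "(\<lambda>n. snd (?s n) - a) \<longlonglongrightarrow> 0"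
      using bd by (auto intro: Lim_null_comparison[OF _ lim] Lim_null_comparison[OF _ lim'])
    then have "(\<lambda>n. (fst (?s n), snd (?s n))) \<longlonglongrightarrow> (a, a)"
      by (intro tendsto_Pair) (auto simp: LIM_zero_iff)
    moreover have "secant_iter p n z \<noteq> None" for n using iter[of n] by auto
    ultimately show "z \<in> secant_basin p a" by (simp add: secant_basin_def)
  qed
  moreover have "open U" by (auto simp: U_def intro: open_Times)
  moreover have "(a, a) \<in> U" using ce b by (simp add: U_def)
  ultimately show ?thesis by blast
qed

section \<open>Even multiplicity\<close>

lemma secant_iter_fixed:
  assumes "poly p \<tau> = 0" "secant_iter p m z = Some (\<tau>, \<tau>)"
  shows "secant_iter p (m + n) z = Some (\<tau>, \<tau>)"
  using assms by (induction n) (auto simp: secant_map_root)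

lemma secant_basin_eventually_fixed:
  assumes "poly p \<tau> = 0" "secant_iter p m z = Some (\<tau>, \<tau>)"
  shows "z \<in> secant_basin p \<tau>"
proof -
  have fixed: "secant_iter p n z = Some (\<tau>, \<tau>)" if "n \<ge> m" for n
    using secant_iter_fixed[OF assms, of "n - m"] that by simp
  have "secant_iter p n z \<noteq> None" for n
  \<comment> \<open>\<open>None\<close> is absorbing under iteration, so an undefined iterate would
    contradict the later fixed values.\<close>
  proof
    assume none: "secant_iter p n z = None"
    have "secant_iter p (n + k) z = None" for k
      using none by (induction k) auto
    from this[of m] fixed[of "n + m"] show False by simp
  qed
  moreover have "(\<lambda>n. the (secant_iter p n z)) \<longlonglongrightarrow> (\<tau>, \<tau>)"
    by (rule tendsto_eventually) (auto simp: fixed eventually_sequentially intro!: exI[of _ m])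
  ultimately show ?thesis by (simp add: secant_basin_def)
qed

text \<open>The line through \<open>(y, poly p y)\<close> has slope
  \<open>poly p y * \<kappa> y\<close>. For \<open>y\<close> close to the right of \<open>a\<close>
  it passes above the graph at \<open>a\<close> and below it at a fixed point to the left, up to the
  common sign of \<open>poly p\<close> near \<open>a\<close>; the intermediate value theorem gives
  \<open>x\<close>.\<close>

lemma even_multiplicity_chord:
  fixes p g :: "real poly"
  assumes p: "p = [:-a, 1:] ^ d * g" and g: "poly g a \<noteq> 0" and d: "even d" "d \<ge> 2"
    and \<kappa>: "isCont \<kappa> a" and e: "e > 0"
  obtains x y where "a - e < x" "x < a" "a < y" "y < a + e" "poly p y \<noteq> 0"
    "poly p x = poly p y * (1 + \<kappa> y * (x - y))"
proof -
  \<comment> \<open>The factor \<open>poly g a\<close> makes \<open>P\<close> positive on both sides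
    of \<open>a\<close>, whatever the sign of \<open>poly g a\<close>.\<close>
  define P where "P = (\<lambda>x. poly p x * poly g a)"
  have "((\<lambda>x. poly g x * poly g a) \<longlongrightarrow> poly g a * poly g a) (nhds a)"
    by (intro tendsto_intros filterlim_ident)
  then have "\<forall>\<^sub>F x in nhds a. poly g x * poly g a > 0"
    by (rule order_tendstoD(1)) (use g in \<open>auto simp: zero_less_mult_iff\<close>)
  then obtain r where r: "r > 0" "\<And>x. \<bar>x - a\<bar> < r \<Longrightarrow> poly g x * poly g a > 0"
    by (auto simp: eventually_nhds_metric dist_real_def)
  have P: "P x > 0" if "\<bar>x - a\<bar> < r" "x \<noteq> a" for x
  proof -
    have "P x = (x - a) ^ d * (poly g x * poly g a)"
      by (simp add: P_def p poly_power)
    moreover have "(x - a) ^ d > 0" using d that by (simp add: zero_less_power_eq)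
    ultimately show ?thesis using r(2)[of x] that by simp
  qed
  have Pa: "P a = 0" using d by (simp add: P_def p poly_power)
  \<comment> \<open>\<open>u\<close> is fixed before \<open>y\<close>, so letting \<open>y\<close>
    tend to \<open>a\<close> sends the height of the line at \<open>u\<close> to 0, below
    \<open>P u\<close>.\<close>
  define u where "u = a - min e r / 2"
  have u: "a - e < u" "u < a" "\<bar>u - a\<bar> < r" using e r(1) by (auto simp: u_def min_def)
  then have Pu: "P u > 0" by (intro P) auto
  have cont: "isCont (\<lambda>y. P y * (1 + \<kappa> y * (u - y))) a" "isCont (\<lambda>y. 1 + \<kappa> y * (a - y)) a"
    unfolding P_def by (intro continuous_intros \<kappa>)+
  have "\<forall>\<^sub>F y in at_right a. P y * (1 + \<kappa> y * (u - y)) < P u"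
    using cont(1) Pu Pa
    by (intro order_tendstoD(2)[of _ 0]) (auto simp: isCont_def intro: tendsto_mono[OF at_within_le_at])
  moreover have "\<forall>\<^sub>F y in at_right a. 1 + \<kappa> y * (a - y) > 0"
    using cont(2)
    by (intro order_tendstoD(1)[of _ 1]) (auto simp: isCont_def intro: tendsto_mono[OF at_within_le_at])
  moreover have "\<forall>\<^sub>F y in at_right a. y \<in> {a<..<a + min e r}"
    using e r(1) by (intro eventually_at_right_real) auto
  ultimately have "\<forall>\<^sub>F y in at_right a. P y * (1 + \<kappa> y * (u - y)) < P u \<and>
      1 + \<kappa> y * (a - y) > 0 \<and> y \<in> {a<..<a + min e r}"
    by (intro eventually_conj)
  then obtain y where y: "P y * (1 + \<kappa> y * (u - y)) < P u" "1 + \<kappa> y * (a - y) > 0"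
      "a < y" "y < a + e" "y < a + r"
    by (auto dest!: eventually_happens)
  have Py: "P y > 0" using y by (intro P) auto
  define F where "F = (\<lambda>x. P x - P y * (1 + \<kappa> y * (x - y)))"
  have "\<exists>x\<ge>u. x \<le> a \<and> F x = 0"
  proof (rule IVT2')
    show "F a \<le> 0" using Pa Py y(2) by (simp add: F_def)
    show "0 \<le> F u" using y(1) by (simp add: F_def)
    show "continuous_on {u..a} F" unfolding F_def P_def by (intro continuous_intros)
  qed (use u in auto)
  then obtain x where x: "u \<le> x" "x \<le> a" "F x = 0" by blast
  have "F a < 0" using Pa Py y(2) by (simp add: F_def)
  with x have "x \<noteq> a" by auto
  show thesis
  proof (rule that[of x y])
    show "poly p y \<noteq> 0" using Py by (auto simp: P_def)
    show "poly p x = poly p y * (1 + \<kappa> y * (x - y))"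
      using x(3) g by (simp add: F_def P_def)
  qed (use x u y \<open>x \<noteq> a\<close> in auto)
qed

lemma secant_quot_chord:
  assumes "poly p x = poly p y * (1 + k * (x - y))" "x \<noteq> y"
  shows "secant_quot p x y = poly p y * k"
proof -
  have "(x - y) * secant_quot p x y = (x - y) * (poly p y * k)"
    using secant_quot[of p x y] assms(1) by (simp add: algebra_simps)
  with assms(2) show ?thesis by simp
qed

lemma dist_diag_less:
  fixes x y a e :: real
  assumes "a - e / 2 < x" "x < a + e / 2" "a - e / 2 < y" "y < a + e / 2"
  shows "dist (x, y) (a, a) < e"
proof -
  have "dist (x, y) (a, a) \<le> dist x a + dist y a"
    unfolding dist_Pair_Pair by (rule sqrt_sum_squares_le_sum) auto
  also have "\<dots> < e" using assms by (auto simp: dist_real_def)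
  finally show ?thesis .
qed

lemma even_multiplicity_not_interior:
  fixes p g :: "real poly"
  assumes p: "p = [:-a, 1:] ^ d * g" and g: "poly g a \<noteq> 0" and d: "even d" "d \<ge> 2"
  shows "(a, a) \<notin> interior (secant_basin p \<tau>)"
proof
  assume "(a, a) \<in> interior (secant_basin p \<tau>)"
  then obtain e where e: "e > 0" "ball (a, a) e \<subseteq> secant_basin p \<tau>"
    by (auto simp: mem_interior)
  \<comment> \<open>The horizontal chord: equal values at distinct points make the secant quotient
    vanish off the diagonal.\<close>
  obtain x y where xy: "a - e / 2 < x" "x < a" "a < y" "y < a + e / 2"
    "poly p x = poly p y * (1 + 0 * (x - y))"
    by (rule even_multiplicity_chord[OF assms continuous_const[of _ 0], of "e / 2"])
      (use e(1) in auto)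
  then have "secant_iter p 1 (x, y) = None"
    using secant_quot_chord[of p x y 0] by (simp add: secant_map_def)
  moreover have "dist (x, y) (a, a) < e" using xy by (intro dist_diag_less) auto
  then have "(x, y) \<in> secant_basin p \<tau>" using e(2) by (auto simp: dist_commute)
  ultimately show False unfolding secant_basin_def by blast
qed

lemma even_multiplicity_closure:
  fixes p g :: "real poly"
  assumes p: "p = [:-a, 1:] ^ d * g" and g: "poly g a \<noteq> 0" and d: "even d" "d \<ge> 2"
    and \<tau>: "poly p \<tau> = 0" "\<tau> \<noteq> a"
  shows "(a, a) \<in> closure (secant_basin p \<tau>)"
  unfolding closure_approachable
proof (intro allI impI)
  fix e :: real assume e: "e > 0"
  \<comment> \<open>The bound \<open>\<bar>\<tau> - a\<bar>\<close> keeps \<open>y\<close> away from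
    \<open>\<tau>\<close>.\<close>
  define e' where "e' = min (e / 2) \<bar>\<tau> - a\<bar>"
  have e': "e' > 0" "e' \<le> e / 2" using e \<tau> by (auto simp: e'_def min_def)
  \<comment> \<open>With this \<open>\<kappa>\<close> the line vanishes at \<open>\<tau>\<close>, so
    the secant step lands on \<open>\<tau>\<close>.\<close>
  have cont: "isCont (\<lambda>y. 1 / (y - \<tau>)) a" using \<tau> by (intro continuous_intros) auto
  obtain x y where xy: "a - e' < x" "x < a" "a < y" "y < a + e'" "poly p y \<noteq> 0"
    and chord: "poly p x = poly p y * (1 + 1 / (y - \<tau>) * (x - y))"
    by (rule even_multiplicity_chord[OF p g d cont e'(1)])
  have "y \<noteq> \<tau>" using xy \<tau> by auto
  have q: "secant_quot p x y = poly p y * (1 / (y - \<tau>))"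
    using xy by (intro secant_quot_chord chord) auto
  then have q0: "secant_quot p x y \<noteq> 0" using xy \<open>y \<noteq> \<tau>\<close> by simp
  have "poly p y / secant_quot p x y = y - \<tau>"
    using q xy \<open>y \<noteq> \<tau>\<close> by simp
  then have "(y * secant_quot p x y - poly p y) / secant_quot p x y = \<tau>"
    using q0 by (simp add: diff_divide_distrib)
  then have 1: "secant_map p (x, y) = Some (y, \<tau>)"
    using q0 by (simp add: secant_map_def)
  have 2: "secant_map p (y, \<tau>) = Some (\<tau>, \<tau>)"
    using xy \<tau> by (subst secant_map_off_diag) auto
  have "secant_iter p 2 (x, y) = Some (\<tau>, \<tau>)"
    using 1 2 by (simp add: numeral_2_eq_2)
  then have "(x, y) \<in> secant_basin p \<tau>"
    using \<tau> by (intro secant_basin_eventually_fixed)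
  moreover have "dist (x, y) (a, a) < e" using xy e' by (intro dist_diag_less) auto
  ultimately show "\<exists>z\<in>secant_basin p \<tau>. dist z (a, a) < e" by blast
qed

theorem theoremA:
  fixes p :: "real poly" and k d :: nat and \<alpha> :: real
  assumes "lead_coeff p = 1"
    and "degree p = k"
    and "k \<ge> 2"
    and "poly p \<alpha> = 0"
    and "has_multiplicity p \<alpha> d"
    and "d \<ge> 2"
  shows "(odd d \<longrightarrow>
            (\<alpha>, \<alpha>) \<in> secant_basin p \<alpha> \<and>
            (\<exists>U. open U \<and> (\<alpha>, \<alpha>) \<in> U \<and> U \<subseteq> secant_basin p \<alpha>)) \<and>
         (even d \<longrightarrow>
            (\<alpha>, \<alpha>) \<in> frontier (secant_basin p \<alpha>) \<and>
            (\<alpha>, \<alpha>) \<in> (\<Inter>\<tau>\<in>{\<tau>. poly p \<tau> = 0 \<and> poly (pderiv p) \<tau> \<noteq> 0}.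
                          frontier (secant_basin p \<tau>)))"
proof -
  have "p \<noteq> 0" "order \<alpha> p = d"
    using assms by (auto simp: has_multiplicity_iff_order)
  then obtain g where p: "p = [:-\<alpha>, 1:] ^ d * g" and "\<not> [:-\<alpha>, 1:] dvd g"
    using order_decomp[of p \<alpha>] by auto
  then have g: "poly g \<alpha> \<noteq> 0" by (simp add: poly_eq_0_iff_dvd)
  have fixed: "(\<alpha>, \<alpha>) \<in> secant_basin p \<alpha>"
    using assms by (intro secant_basin_eventually_fixed[of _ _ 0]) auto
  \<comment> \<open>Proved for every real root \<open>\<tau>\<close>, which covers both
    \<open>\<alpha>\<close> itself and all simple roots.\<close>
  have "(\<alpha>, \<alpha>) \<in> frontier (secant_basin p \<tau>)"
    if "even d" "poly p \<tau> = 0" for \<tau>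
  proof (cases "\<tau> = \<alpha>")
    case True
    then show ?thesis
      using fixed closure_subset even_multiplicity_not_interior[OF p g that(1) assms(6)]
      by (auto simp: frontier_def)
  next
    case False
    then show ?thesis
      using even_multiplicity_closure[OF p g that(1) assms(6) that(2)]
        even_multiplicity_not_interior[OF p g that(1) assms(6)]
      by (auto simp: frontier_def)
  qed
  with fixed assms odd_multiplicity_basin_neighbourhood[OF p g] show ?thesis by blast
qed

end
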